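(* Let $\mathcal{I}$ and $\mathcal{J}$ be the focal and partner samples of the pair-interaction model described in the context. Assume that the treatments $\{D_k\}_{k\in\mathcal{I}\cup\mathcal{J}}$ are mutually independent with $\Pr(D_i=d)=p_d^{\mathcal{I}}$ for $i\in\mathcal{I}$ and $\Pr(D_j=d)=p_d^{\mathcal{J}}$ for $j\in\mathcal{J}$, $d\in\{0,1\}$, and that for each $(d,s)\in\{0,1\}^2$, $(D_i,D_{j(i)})$ is independent of $(Y_i(d,s),A_{j(i)})$. Assume also that the potential outcomes $\{Y_i(d,s)\}_{(d,s)\in\{0,1\}^2}$ together with $A_{j(i)}$ are independent and identically distributed across $i\in\mathcal{I}$, with $\Pr(A_{j(i)}=a)=p_a^A$, $a\in\{0,1\}$. Suppose $(\beta_d^{wls},\beta_s^{wls})$ is determined (through a unique minimizer) by $$(\beta_0^{wls}, \beta_d^{wls}, \beta_s^{wls}) = \operatorname*{argmin}_{b_0, b_d, b_s\in\mathbb{R}} \mathbb{E}[A_{j(i)} (Y_i - b_0 - b_d D_i - b_s D_{j(i)})^2].$$ Then (i) $\beta_d^{wls} = \mathbb{E}[\bar\delta_i\mid A_{j(i)}= 1]$ and (ii) $\beta_s^{wls} = \mathbb{E}[\bar\tau_i\mid A_{j(i)}= 1]$.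
   Context: Pair-interaction model. There are two disjoint samples: the focal sample $\mathcal{I}$ and the partner sample $\mathcal{J}$. Each $i\in\mathcal{I}$ has exactly one potential partner $j(i)\in\mathcal{J}$, and $j(i)\neq j(i')$ for $i\neq i'$. Each unit $k\in\mathcal{I}\cup\mathcal{J}$ has a random binary treatment $D_k\in\{0,1\}$. For each pair, $A_{j(i)}\in\{0,1\}$ is a random variable indicating whether $j(i)$'s treatment affects $i$'s outcome. The spillover variable is $S_i := A_{j(i)}D_{j(i)}\in\{0,1\}$. For $(d,s)\in\{0,1\}^2$, $Y_i(d,s)$ is a real random variable (potential outcome), and the observed outcome is $Y_i=\sum_{(d,s)\in\{0,1\}^2}\mathbf{1}\{D_i=d,S_i=s\}Y_i(d,s)$. Experimental design: the treatments $\{D_k\}_{k\in\mathcal{I}\cup\mathcal{J}}$ are mutually independent with $\Pr(D_i=d)=p_d^{\mathcal{I}}$ for $i\in\mathcal{I}$ and $\Pr(D_j=d)=p_d^{\mathcal{J}}$ for $j\in\mathcal{J}$, $d\in\{0,1\}$. In addition, for each $(d,s)\in\{0,1\}^2$, $(D_i,D_{j(i)})$ is independent of $(Y_i(d,s),A_{j(i)})$. IID sampling: the potential outcomes $\{Y_i(d,s)\}_{(d,s)\in\{0,1\}^2}$ together with $A_{j(i)}$ are independent and identically distributed across $i\in\mathcal{I}$, with $\Pr(A_{j(i)}=a)=p_a^A$, $a\in\{0,1\}$. ($A_{j(i)}$ may be dependent on $Y_i(d,s)$.) Because of the identical distributions across $i$, the expectations do not depend on $i\in\mathcal{I}$. Potential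 outcomes have finite second moments. Direct and spillover effects: $\delta_i(s):=Y_i(1,s)-Y_i(0,s)$, $\bar\delta_i:=\delta_i(1)p_1^{\mathcal{J}}+\delta_i(0)p_0^{\mathcal{J}}$, $\tau_i(d):=Y_i(d,1)-Y_i(d,0)$, $\bar\tau_i:=\tau_i(1)p_1^{\mathcal{I}}+\tau_i(0)p_0^{\mathcal{I}}$. *)

theory Defs
  imports "HOL-Probability.Probability"
begin

text \<open>
  Units have type \<open>'u\<close>, the probability space \<open>M\<close> has sample points of type \<open>'w\<close>.
  Binary variables are \<open>nat\<close>-valued with range \<open>{0, 1}\<close>. The indicator \<open>A\<close> is indexed by
  partners: \<open>A (j i)\<close> says whether the treatment of \<open>j i\<close> affects the outcome of \<open>i\<close>.
  \<open>Y i (d, s)\<close> is a potential outcome of \<open>i\<close>.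
\<close>

definition spillover ::
  "('u \<Rightarrow> 'u) \<Rightarrow> ('u \<Rightarrow> 'w \<Rightarrow> nat) \<Rightarrow> ('u \<Rightarrow> 'w \<Rightarrow> nat) \<Rightarrow> 'u \<Rightarrow> 'w \<Rightarrow> nat"
  where "spillover j D A i \<omega> = A (j i) \<omega> * D (j i) \<omega>"

definition observed_outcome ::
  "('u \<Rightarrow> 'u) \<Rightarrow> ('u \<Rightarrow> 'w \<Rightarrow> nat) \<Rightarrow> ('u \<Rightarrow> 'w \<Rightarrow> nat) \<Rightarrow> ('u \<Rightarrow> nat \<times> nat \<Rightarrow> 'w \<Rightarrow> real)
    \<Rightarrow> 'u \<Rightarrow> 'w \<Rightarrow> real"
  where "observed_outcome j D A Y i \<omega> =
    (\<Sum>(d, s)\<in>{0, 1} \<times> {0, 1}. of_bool (D i \<omega> = d \<and> spillover j D A i \<omega> = s) * Y i (d, s) \<omega>)"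

definition direct_effect :: "('u \<Rightarrow> nat \<times> nat \<Rightarrow> 'w \<Rightarrow> real) \<Rightarrow> 'u \<Rightarrow> nat \<Rightarrow> 'w \<Rightarrow> real"
  where "direct_effect Y i s \<omega> = Y i (1, s) \<omega> - Y i (0, s) \<omega>"

definition avg_direct_effect ::
  "(nat \<Rightarrow> real) \<Rightarrow> ('u \<Rightarrow> nat \<times> nat \<Rightarrow> 'w \<Rightarrow> real) \<Rightarrow> 'u \<Rightarrow> 'w \<Rightarrow> real"
  where "avg_direct_effect pJ Y i \<omega> =
    direct_effect Y i 1 \<omega> * pJ 1 + direct_effect Y i 0 \<omega> * pJ 0"

definition spillover_effect :: "('u \<Rightarrow> nat \<times> nat \<Rightarrow> 'w \<Rightarrow> real) \<Rightarrow> 'u \<Rightarrow> nat \<Rightarrow> 'w \<Rightarrow> real"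
  where "spillover_effect Y i d \<omega> = Y i (d, 1) \<omega> - Y i (d, 0) \<omega>"

definition avg_spillover_effect ::
  "(nat \<Rightarrow> real) \<Rightarrow> ('u \<Rightarrow> nat \<times> nat \<Rightarrow> 'w \<Rightarrow> real) \<Rightarrow> 'u \<Rightarrow> 'w \<Rightarrow> real"
  where "avg_spillover_effect pI Y i \<omega> =
    spillover_effect Y i 1 \<omega> * pI 1 + spillover_effect Y i 0 \<omega> * pI 0"

text \<open>
  Expectation conditional on the event \<open>P\<close>. It is the elementary conditional expectation
  when \<open>P\<close> has positive probability, and a junk value otherwise.
\<close>

definition cond_expect :: "'w measure \<Rightarrow> ('w \<Rightarrow> real) \<Rightarrow> ('w \<Rightarrow> bool) \<Rightarrow> real"
  where "cond_expect M X P = (\<integral>\<omega>. X \<omega> \<partial>uniform_measure M {\<omega> \<in> space M. P \<omega>})"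

locale pair_interaction = prob_space M
  for M :: "'w measure" +
  fixes I J :: "'u set"
    and j :: "'u \<Rightarrow> 'u"
    and D A :: "'u \<Rightarrow> 'w \<Rightarrow> nat"
    and Y :: "'u \<Rightarrow> nat \<times> nat \<Rightarrow> 'w \<Rightarrow> real"
  assumes samples_disjoint: "I \<inter> J = {}"
    and partner_in: "j ` I \<subseteq> J"
    and partner_inj: "inj_on j I"
    and treatment_rv: "k \<in> I \<union> J \<Longrightarrow> random_variable (count_space UNIV) (D k)"
    and treatment_binary: "k \<in> I \<union> J \<Longrightarrow> \<omega> \<in> space M \<Longrightarrow> D k \<omega> \<in> {0, 1}"
    and interaction_rv: "i \<in> I \<Longrightarrow> random_variable (count_space UNIV) (A (j i))"
    and interaction_binary: "i \<in> I \<Longrightarrow> \<omega> \<in> space M \<Longrightarrow> A (j i) \<omega> \<in> {0, 1}"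
    and outcome_rv:
      "i \<in> I \<Longrightarrow> ds \<in> {0, 1} \<times> {0, 1} \<Longrightarrow> random_variable borel (Y i ds)"
    and outcome_second_moment:
      "i \<in> I \<Longrightarrow> ds \<in> {0, 1} \<times> {0, 1} \<Longrightarrow> integrable M (\<lambda>\<omega>. (Y i ds \<omega>)\<^sup>2)"

locale experimental_design = pair_interaction +
  fixes pI pJ :: "nat \<Rightarrow> real"
  assumes treatments_indep: "indep_vars (\<lambda>_. count_space UNIV) D (I \<union> J)"
    and prob_focal: "i \<in> I \<Longrightarrow> d \<in> {0, 1} \<Longrightarrow> \<P>(\<omega> in M. D i \<omega> = d) = pI d"
    and prob_partner: "k \<in> J \<Longrightarrow> d \<in> {0, 1} \<Longrightarrow> \<P>(\<omega> in M. D k \<omega> = d) = pJ d"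
    and treatments_indep_outcomes:
      "i \<in> I \<Longrightarrow> ds \<in> {0, 1} \<times> {0, 1} \<Longrightarrow>
        indep_var (count_space UNIV \<Otimes>\<^sub>M count_space UNIV) (\<lambda>\<omega>. (D i \<omega>, D (j i) \<omega>))
                  (borel \<Otimes>\<^sub>M count_space UNIV) (\<lambda>\<omega>. (Y i ds \<omega>, A (j i) \<omega>))"

text \<open>
  The random vector \<open>((Y i (d, s))\<^bsub>(d, s)\<in>{0,1}\<^sup>2\<^esub>, A (j i))\<close> and the measurable space of its values.
\<close>

definition unit_vector ::
  "('u \<Rightarrow> 'u) \<Rightarrow> ('u \<Rightarrow> 'w \<Rightarrow> nat) \<Rightarrow> ('u \<Rightarrow> nat \<times> nat \<Rightarrow> 'w \<Rightarrow> real) \<Rightarrow> 'u \<Rightarrow> 'w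
    \<Rightarrow> (nat \<times> nat \<Rightarrow> real) \<times> nat"
  where "unit_vector j A Y i \<omega> = (\<lambda>ds\<in>{0, 1} \<times> {0, 1}. Y i ds \<omega>, A (j i) \<omega>)"

definition unit_space :: "((nat \<times> nat \<Rightarrow> real) \<times> nat) measure"
  where "unit_space = (\<Pi>\<^sub>M ds\<in>{0, 1} \<times> {0, 1}. borel) \<Otimes>\<^sub>M count_space UNIV"

locale iid_sampling = pair_interaction +
  fixes pA :: "nat \<Rightarrow> real"
  assumes units_indep: "indep_vars (\<lambda>_. unit_space) (unit_vector j A Y) I"
    and units_identically_distributed:
      "i \<in> I \<Longrightarrow> i' \<in> I \<Longrightarrow>
        distr M unit_space (unit_vector j A Y i) = distr M unit_space (unit_vector j A Y i')"
    and prob_interaction: "i \<in> I \<Longrightarrow> a \<in> {0, 1} \<Longrightarrow> \<P>(\<omega> in M. A (j i) \<omega> = a) = pA a"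

definition wls_objective ::
  "'w measure \<Rightarrow> ('u \<Rightarrow> 'u) \<Rightarrow> ('u \<Rightarrow> 'w \<Rightarrow> nat) \<Rightarrow> ('u \<Rightarrow> 'w \<Rightarrow> nat) \<Rightarrow>
    ('u \<Rightarrow> nat \<times> nat \<Rightarrow> 'w \<Rightarrow> real) \<Rightarrow> 'u \<Rightarrow> real \<times> real \<times> real \<Rightarrow> real"
  where "wls_objective M j D A Y i = (\<lambda>(b0, bd, bs).
    \<integral>\<omega>. real (A (j i) \<omega>) *
      (observed_outcome j D A Y i \<omega> - b0 - bd * real (D i \<omega>) - bs * real (D (j i) \<omega>))\<^sup>2 \<partial>M)"

end

theory Submission
  imports Defs
begin

text \<open>
  On the event \<open>A (j i) = 1\<close> the observed outcome is \<open>Y i (D i, D (j i))\<close>. Since the treatments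
  are independent of each other and of \<open>(Y i ds, A (j i))\<close>, the objective is an explicit quadratic
  polynomial in \<open>(b0, bd, bs)\<close> with coefficients built from the moments of the outcomes weighted
  by \<open>A (j i)\<close>. Along the direction \<open>(- pI 1, 1, 0)\<close>, which is the centred own treatment
  \<open>D i - pI 1\<close>, and along \<open>(- pJ 1, 0, 1)\<close>, it is a parabola whose vertex is the asserted
  conditional expectation. Uniqueness of the minimizer rules out the degenerate case
  in which the parabola is constant.
\<close>

section \<open>Parabolas and elementary conditional expectation\<close>

text \<open>The signs of \<open>w\<close> and \<open>a\<close> are left open: only the product
  \<open>w * a\<close> matters, and adding the hypothesis at 1 and -1 shows that it is
  positive.\<close>

lemma strict_parabola_min_at_zero:
  fixes w a g :: real
  assumes pos: "\<And>t. t \<noteq> 0 \<Longrightarrow> 0 < w * (a * t\<^sup>2 - 2 * t * g)"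
  shows "a \<noteq> 0" and "g = 0"
proof -
  have "0 < w * a"
    using pos[of 1] pos[of "-1"] by (simp add: algebra_simps)
  then show "a \<noteq> 0" by auto
  show "g = 0"
  proof (rule ccontr)
    assume "g \<noteq> 0"
    \<comment> \<open>The point \<open>g / a\<close> is the vertex of the parabola, where its value
      cannot exceed the value 0 attained at the origin.\<close>
    then have "0 < w * (a * (g / a)\<^sup>2 - 2 * (g / a) * g)"
      using \<open>a \<noteq> 0\<close> by (intro pos) simp
    also have "\<dots> = - (w * a) * (g / a)\<^sup>2"
      using \<open>a \<noteq> 0\<close> by (simp add: field_simps power2_eq_square)
    finally have "w * a * (g / a)\<^sup>2 < 0"
      by simp
    moreover have "0 \<le> w * a * (g / a)\<^sup>2"
      by (rule mult_nonneg_nonneg[OF less_imp_le[OF \<open>0 < w * a\<close>] zero_le_power2])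
    ultimately show False by linarith
  qed
qed

text \<open>The uniform measure on the event has density indicator over probability with respect to
  \<open>M\<close>, so its integral is a weighted expectation.\<close>

lemma (in prob_space) cond_expect_eq:
  assumes [measurable]: "X \<in> borel_measurable M" "Measurable.pred M P"
    and pos: "\<P>(\<omega> in M. P \<omega>) \<noteq> 0"
  shows "cond_expect M X P = expectation (\<lambda>\<omega>. of_bool (P \<omega>) * X \<omega>) / \<P>(\<omega> in M. P \<omega>)"
proof -
  let ?S = "{\<omega> \<in> space M. P \<omega>}"
  have "uniform_measure M ?S = density M (\<lambda>\<omega>. ennreal (indicator ?S \<omega> / prob ?S))"
    unfolding uniform_measure_def
    using pos
    by (intro arg_cong2[where f = density] refl ext)
      (auto simp: emeasure_eq_measure divide_ennreal ennreal_indicator[symmetric]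
        zero_less_measure_iff simp del: ennreal_indicator)
  then have "cond_expect M X P = expectation (\<lambda>\<omega>. (indicator ?S \<omega> / prob ?S) *\<^sub>R X \<omega>)"
    unfolding cond_expect_def by (simp add: integral_density)
  also have "\<dots> = expectation (\<lambda>\<omega>. of_bool (P \<omega>) * X \<omega> / prob ?S)"
    by (intro Bochner_Integration.integral_cong) (auto simp: indicator_def)
  finally show ?thesis
    by simp
qed

context experimental_design
begin

section \<open>Joint law of the two treatments\<close>

lemma partner_neq:
  assumes "i \<in> I"
  shows "j i \<in> J" and "i \<noteq> j i"
  using assms partner_in samples_disjoint by blast+

text \<open>\<open>pI\<close> is an arbitrary function a priori; the binary treatment of an actual
  unit of \<open>I\<close> forces its values at 0 and 1 to sum to one.\<close>

lemma prob_focal_0: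
  assumes "i \<in> I"
  shows "pI 0 = 1 - pI 1"
proof -
  have [measurable]: "D i \<in> measurable M (count_space UNIV)"
    using assms treatment_rv by blast
  have "{\<omega> \<in> space M. D i \<omega> = 0} = space M - {\<omega> \<in> space M. D i \<omega> = 1}"
    using treatment_binary assms by fastforce
  then have "\<P>(\<omega> in M. D i \<omega> = 0) = 1 - \<P>(\<omega> in M. D i \<omega> = 1)"
    by (simp add: prob_compl)
  then show ?thesis
    using prob_focal[OF assms, of 0] prob_focal[OF assms, of 1] by simp
qed

lemma prob_partner_0:
  assumes "k \<in> J"
  shows "pJ 0 = 1 - pJ 1"
proof -
  have [measurable]: "D k \<in> measurable M (count_space UNIV)"
    using assms treatment_rv by blast
  have "{\<omega> \<in> space M. D k \<omega> = 0} = space M - {\<omega> \<in> space M. D k \<omega> = 1}"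
    using treatment_binary assms by fastforce
  then have "\<P>(\<omega> in M. D k \<omega> = 0) = 1 - \<P>(\<omega> in M. D k \<omega> = 1)"
    by (simp add: prob_compl)
  then show ?thesis
    using prob_partner[OF assms, of 0] prob_partner[OF assms, of 1] by simp
qed

lemma prob_treatment_pair:
  assumes i: "i \<in> I" and de: "d \<in> {0, 1}" "e \<in> {0, 1}"
  shows "\<P>(\<omega> in M. D i \<omega> = d \<and> D (j i) \<omega> = e) = pI d * pJ e"
proof -
  \<comment> \<open>Mutual independence is applied to the finite index set \<open>{i, j i}\<close>.
    Its two elements differ because the samples are disjoint, so the conditional picks one singleton
    for each.\<close>
  have "prob (\<Inter>k\<in>{i, j i}. D k -` (if k = i then {d} else {e}) \<inter> space M)
      = (\<Prod>k\<in>{i, j i}. prob (D k -` (if k = i then {d} else {e}) \<inter> space M))"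
    using i partner_neq[OF i] by (intro indep_varsD[OF treatments_indep]) auto
  also have "\<dots> = \<P>(\<omega> in M. D i \<omega> = d) * \<P>(\<omega> in M. D (j i) \<omega> = e)"
    using partner_neq[OF i]
    by (auto simp: vimage_def Int_def conj_commute intro!: arg_cong2[where f = "(*)"])
  also have "(\<Inter>k\<in>{i, j i}. D k -` (if k = i then {d} else {e}) \<inter> space M)
      = {\<omega> \<in> space M. D i \<omega> = d \<and> D (j i) \<omega> = e}"
    using partner_neq[OF i] by auto
  finally show ?thesis
    using prob_focal[OF i de(1)] prob_partner[OF partner_neq(1)[OF i] de(2)] by simp
qed

section \<open>Moments weighted by the interaction indicator\<close>

text \<open>The weight takes values in {0, 1}, so the three integrands are dominated by 1, the
  outcome and its square; a finite second moment implies a finite first moment.\<close>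

lemma
  assumes i: "i \<in> I" and ds: "ds \<in> {0, 1} \<times> {0, 1}"
  shows integrable_interaction: "integrable M (\<lambda>\<omega>. real (A (j i) \<omega>))"
    and integrable_interaction_outcome: "integrable M (\<lambda>\<omega>. real (A (j i) \<omega>) * Y i ds \<omega>)"
    and integrable_interaction_outcome_sq:
      "integrable M (\<lambda>\<omega>. real (A (j i) \<omega>) * (Y i ds \<omega>)\<^sup>2)"
proof -
  have [measurable]: "A (j i) \<in> measurable M (count_space UNIV)" "Y i ds \<in> borel_measurable M"
    using interaction_rv i outcome_rv ds by blast+
  have Y: "integrable M (\<lambda>\<omega>. (Y i ds \<omega>)\<^sup>2)" "integrable M (Y i ds)"
    using outcome_second_moment[OF i ds] by (auto intro: square_integrable_imp_integrable)
  have A: "A (j i) \<omega> \<in> {0, 1}" if "\<omega> \<in> space M" for \<omega>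
    using interaction_binary[OF i that] .
  show "integrable M (\<lambda>\<omega>. real (A (j i) \<omega>))"
    by (rule Bochner_Integration.integrable_bound[of M "\<lambda>_. 1 :: real"]) (use A in fastforce)+
  show "integrable M (\<lambda>\<omega>. real (A (j i) \<omega>) * Y i ds \<omega>)"
    by (rule Bochner_Integration.integrable_bound[OF Y(2)])
      (use A in \<open>force simp: abs_mult intro!: AE_I2\<close>)+
  show "integrable M (\<lambda>\<omega>. real (A (j i) \<omega>) * (Y i ds \<omega>)\<^sup>2)"
    by (rule Bochner_Integration.integrable_bound[OF Y(1)])
      (use A in \<open>force simp: abs_mult intro!: AE_I2\<close>)+
qed

lemma
  assumes i: "i \<in> I" and ds: "ds \<in> {0, 1} \<times> {0, 1}"
  shows integrable_interaction_residual:
      "integrable M (\<lambda>\<omega>. real (A (j i) \<omega>) * (Y i ds \<omega> - c)\<^sup>2)"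
    and expectation_interaction_residual:
      "expectation (\<lambda>\<omega>. real (A (j i) \<omega>) * (Y i ds \<omega> - c)\<^sup>2)
        = expectation (\<lambda>\<omega>. real (A (j i) \<omega>) * (Y i ds \<omega>)\<^sup>2)
          - 2 * c * expectation (\<lambda>\<omega>. real (A (j i) \<omega>) * Y i ds \<omega>)
          + c\<^sup>2 * expectation (\<lambda>\<omega>. real (A (j i) \<omega>))"
proof -
  have eq: "(\<lambda>\<omega>. real (A (j i) \<omega>) * (Y i ds \<omega> - c)\<^sup>2)
      = (\<lambda>\<omega>. real (A (j i) \<omega>) * (Y i ds \<omega>)\<^sup>2 - 2 * c * (real (A (j i) \<omega>) * Y i ds \<omega>)
          + c\<^sup>2 * real (A (j i) \<omega>))"
    by (auto simp: power2_eq_square algebra_simps)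
  note int = integrable_interaction[OF i ds] integrable_interaction_outcome[OF i ds]
    integrable_interaction_outcome_sq[OF i ds]
  show "integrable M (\<lambda>\<omega>. real (A (j i) \<omega>) * (Y i ds \<omega> - c)\<^sup>2)"
    unfolding eq using int by simp
  show "expectation (\<lambda>\<omega>. real (A (j i) \<omega>) * (Y i ds \<omega> - c)\<^sup>2)
        = expectation (\<lambda>\<omega>. real (A (j i) \<omega>) * (Y i ds \<omega>)\<^sup>2)
          - 2 * c * expectation (\<lambda>\<omega>. real (A (j i) \<omega>) * Y i ds \<omega>)
          + c\<^sup>2 * expectation (\<lambda>\<omega>. real (A (j i) \<omega>))"
    unfolding eq using int by simp
qed

text \<open>The treatment cell is a function of \<open>(D i, D (j i))\<close> and the weighted
  residual a function of \<open>(Y i ds, A (j i))\<close>; these pairs are independent, so the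
  expectation of the product factorises.\<close>

lemma
  assumes i: "i \<in> I" and ds: "ds \<in> {0, 1} \<times> {0, 1}" and de: "d \<in> {0, 1}" "e \<in> {0, 1}"
  shows integrable_cell: "integrable M (\<lambda>\<omega>. of_bool (D i \<omega> = d \<and> D (j i) \<omega> = e)
      * (real (A (j i) \<omega>) * (Y i ds \<omega> - c)\<^sup>2))"
    and expectation_cell: "expectation (\<lambda>\<omega>. of_bool (D i \<omega> = d \<and> D (j i) \<omega> = e)
      * (real (A (j i) \<omega>) * (Y i ds \<omega> - c)\<^sup>2))
      = pI d * pJ e * expectation (\<lambda>\<omega>. real (A (j i) \<omega>) * (Y i ds \<omega> - c)\<^sup>2)"
proof -
  let ?f = "\<lambda>x :: real \<times> nat. of_bool (fst x = real d \<and> snd x = e) :: real"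
  let ?g = "\<lambda>x :: real \<times> nat. real (snd x) * (fst x - c)\<^sup>2"
  let ?X = "\<lambda>\<omega>. of_bool (D i \<omega> = d \<and> D (j i) \<omega> = e) :: real"
  let ?R = "\<lambda>\<omega>. real (A (j i) \<omega>) * (Y i ds \<omega> - c)\<^sup>2"
  have [measurable]: "D i \<in> measurable M (count_space UNIV)"
      "D (j i) \<in> measurable M (count_space UNIV)"
    using treatment_rv i partner_neq[OF i] by blast+
  \<comment> \<open>\<open>indep_var\<close> takes two variables of the same type, so the first treatment is coerced to \<open>real\<close>.\<close>
  have "indep_var borel (?f \<circ> (\<lambda>\<omega>. case (D i \<omega>, D (j i) \<omega>) of (x, y) \<Rightarrow> (real x, y)))
      borel (?g \<circ> (\<lambda>\<omega>. (Y i ds \<omega>, A (j i) \<omega>)))"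
    by (rule indep_var_compose[OF treatments_indep_outcomes[OF i ds]]) measurable
  then have ind: "indep_var borel ?X borel ?R"
    by (simp add: comp_def)
  have X: "integrable M ?X" "expectation ?X = pI d * pJ e"
  proof -
    have eq: "?X \<omega> = indicator {\<omega> \<in> space M. D i \<omega> = d \<and> D (j i) \<omega> = e} \<omega>" if "\<omega> \<in> space M" for \<omega>
      using that by (simp add: indicator_def)
    show "integrable M ?X"
      by (rule integrable_const_bound[of _ 1]) auto
    show "expectation ?X = pI d * pJ e"
      by (subst Bochner_Integration.integral_cong[OF refl eq])
        (auto simp: prob_treatment_pair[OF i de])
  qed
  note R = integrable_interaction_residual[OF i ds, of c]
  show "integrable M (\<lambda>\<omega>. ?X \<omega> * ?R \<omega>)"
    by (rule indep_var_integrable[OF ind X(1) R])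
  show "expectation (\<lambda>\<omega>. ?X \<omega> * ?R \<omega>) = pI d * pJ e * expectation ?R"
    using indep_var_lebesgue_integral[OF ind X(1) R] X(2) by simp
qed

section \<open>The objective as a quadratic polynomial\<close>

text \<open>If \<open>A (j i)\<close> is 1, the spillover equals the partner's treatment, so on the
  cell (d, e) the observed outcome is \<open>Y i (d, e)\<close>. If it is 0, both sides
  vanish.\<close>

lemma wls_integrand_cells:
  assumes i: "i \<in> I" and \<omega>: "\<omega> \<in> space M"
  shows "real (A (j i) \<omega>) *
      (observed_outcome j D A Y i \<omega> - b0 - bd * real (D i \<omega>) - bs * real (D (j i) \<omega>))\<^sup>2
    = (\<Sum>d\<in>{0, 1}. \<Sum>e\<in>{0, 1}. of_bool (D i \<omega> = d \<and> D (j i) \<omega> = e)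
      * (real (A (j i) \<omega>) * (Y i (d, e) \<omega> - (b0 + bd * real d + bs * real e))\<^sup>2))"
proof -
  have "D i \<omega> \<in> {0, 1}" "D (j i) \<omega> \<in> {0, 1}" "A (j i) \<omega> \<in> {0, 1}"
    using treatment_binary interaction_binary i \<omega> partner_neq[OF i] by blast+
  then show ?thesis
    by (auto simp: observed_outcome_def spillover_def sum.cartesian_product[symmetric]
        algebra_simps)
qed

lemma wls_objective_quadratic:
  assumes i: "i \<in> I"
  shows "wls_objective M j D A Y i (b0, bd, bs) =
    (\<Sum>d\<in>{0, 1}. \<Sum>e\<in>{0, 1}. pI d * pJ e *
      (expectation (\<lambda>\<omega>. real (A (j i) \<omega>) * (Y i (d, e) \<omega>)\<^sup>2)
       - 2 * (b0 + bd * real d + bs * real e) * expectation (\<lambda>\<omega>. real (A (j i) \<omega>) * Y i (d, e) \<omega>)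
       + (b0 + bd * real d + bs * real e)\<^sup>2 * expectation (\<lambda>\<omega>. real (A (j i) \<omega>))))"
proof -
  let ?cell = "\<lambda>d e \<omega>. of_bool (D i \<omega> = d \<and> D (j i) \<omega> = e)
      * (real (A (j i) \<omega>) * (Y i (d, e) \<omega> - (b0 + bd * real d + bs * real e))\<^sup>2)"
  have int: "integrable M (?cell d e)" if "d \<in> {0, 1}" "e \<in> {0, 1}" for d e
    by (rule integrable_cell[OF i _ that]) (use that in auto)
  have "wls_objective M j D A Y i (b0, bd, bs)
      = expectation (\<lambda>\<omega>. \<Sum>d\<in>{0, 1}. \<Sum>e\<in>{0, 1}. ?cell d e \<omega>)"
    unfolding wls_objective_def prod.case
    by (rule Bochner_Integration.integral_cong[OF refl]) (rule wls_integrand_cells[OF i])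
  also have "\<dots> = (\<Sum>d\<in>{0, 1}. expectation (\<lambda>\<omega>. \<Sum>e\<in>{0, 1}. ?cell d e \<omega>))"
    by (intro Bochner_Integration.integral_sum Bochner_Integration.integrable_sum int)
  also have "\<dots> = (\<Sum>d\<in>{0, 1}. \<Sum>e\<in>{0, 1}. expectation (?cell d e))"
    by (intro sum.cong refl Bochner_Integration.integral_sum int)
  also have "\<dots> = (\<Sum>d\<in>{0, 1}. \<Sum>e\<in>{0, 1}. pI d * pJ e *
      expectation (\<lambda>\<omega>. real (A (j i) \<omega>) * (Y i (d, e) \<omega> - (b0 + bd * real d + bs * real e))\<^sup>2))"
    using i by (intro sum.cong refl expectation_cell) auto
  also have "\<dots> = (\<Sum>d\<in>{0, 1}. \<Sum>e\<in>{0, 1}. pI d * pJ e *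
      (expectation (\<lambda>\<omega>. real (A (j i) \<omega>) * (Y i (d, e) \<omega>)\<^sup>2)
       - 2 * (b0 + bd * real d + bs * real e) * expectation (\<lambda>\<omega>. real (A (j i) \<omega>) * Y i (d, e) \<omega>)
       + (b0 + bd * real d + bs * real e)\<^sup>2 * expectation (\<lambda>\<omega>. real (A (j i) \<omega>))))"
    using i by (intro sum.cong refl arg_cong2[where f = "(*)"] expectation_interaction_residual) auto
  finally show ?thesis .
qed

text \<open>A binary \<open>A (j i)\<close> is the indicator of the conditioning event, so its
  expectation is the probability of that event.\<close>

lemma cond_expect_interaction:
  assumes i: "i \<in> I" and [measurable]: "X \<in> borel_measurable M"
    and pos: "expectation (\<lambda>\<omega>. real (A (j i) \<omega>)) \<noteq> 0"
  shows "cond_expect M X (\<lambda>\<omega>. A (j i) \<omega> = 1)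
    = expectation (\<lambda>\<omega>. real (A (j i) \<omega>) * X \<omega>) / expectation (\<lambda>\<omega>. real (A (j i) \<omega>))"
proof -
  have [measurable]: "A (j i) \<in> measurable M (count_space UNIV)"
    using interaction_rv i by blast
  have A: "real (A (j i) \<omega>) = indicator {\<omega> \<in> space M. A (j i) \<omega> = 1} \<omega>"
      "of_bool (A (j i) \<omega> = 1) = real (A (j i) \<omega>)" if "\<omega> \<in> space M" for \<omega>
    using interaction_binary[OF i that] that by auto
  have "expectation (\<lambda>\<omega>. real (A (j i) \<omega>)) = \<P>(\<omega> in M. A (j i) \<omega> = 1)"
    by (subst Bochner_Integration.integral_cong[OF refl A(1)]) auto
  moreover have "expectation (\<lambda>\<omega>. of_bool (A (j i) \<omega> = 1) * X \<omega>)
      = expectation (\<lambda>\<omega>. real (A (j i) \<omega>) * X \<omega>)"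
    by (intro Bochner_Integration.integral_cong refl) (simp only: A(2))
  ultimately show ?thesis
    using pos by (subst cond_expect_eq) auto
qed

end

section \<open>Identification of the two coefficients\<close>

theorem proposition2p3:
  fixes M :: "'w measure" and I J :: "'u set" and j :: "'u \<Rightarrow> 'u"
    and D A :: "'u \<Rightarrow> 'w \<Rightarrow> nat" and Y :: "'u \<Rightarrow> nat \<times> nat \<Rightarrow> 'w \<Rightarrow> real"
    and pI pJ pA :: "nat \<Rightarrow> real" and i :: 'u and \<beta>0 \<beta>d \<beta>s :: real
  assumes "experimental_design M I J j D A Y pI pJ"
    and "iid_sampling M I J j D A Y pA"
    and "i \<in> I"
    and "\<exists>!b. is_arg_min (wls_objective M j D A Y i) (\<lambda>_. True) b"
    and "(\<beta>0, \<beta>d, \<beta>s) = arg_min (wls_objective M j D A Y i) (\<lambda>_. True)"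
  shows "\<beta>d = cond_expect M (avg_direct_effect pJ Y i) (\<lambda>\<omega>. A (j i) \<omega> = 1)
    \<and> \<beta>s = cond_expect M (avg_spillover_effect pI Y i) (\<lambda>\<omega>. A (j i) \<omega> = 1)"
proof -
  interpret experimental_design M I J j D A Y pI pJ by fact
  note i = \<open>i \<in> I\<close>
  let ?f = "wls_objective M j D A Y i"
  define a where "a = expectation (\<lambda>\<omega>. real (A (j i) \<omega>))"
  define m where "m d e = expectation (\<lambda>\<omega>. real (A (j i) \<omega>) * Y i (d, e) \<omega>)" for d e
  define n where "n d e = expectation (\<lambda>\<omega>. real (A (j i) \<omega>) * (Y i (d, e) \<omega>)\<^sup>2)" for d e
  define p q where "p = pI 1" and "q = pJ 1"
  have p0: "pI 0 = 1 - p" and q0: "pJ 0 = 1 - q"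
    unfolding p_def q_def using prob_focal_0 prob_partner_0 i partner_neq[OF i] by blast+
  \<comment> \<open>\<open>arg_min\<close> is a choice operator; the existence half of the
    uniqueness assumption makes its value a genuine minimizer.\<close>
  have min: "is_arg_min ?f (\<lambda>_. True) (\<beta>0, \<beta>d, \<beta>s)"
    unfolding assms(5) arg_min_def using assms(4) by (metis someI_ex)
  have strict: "?f (\<beta>0, \<beta>d, \<beta>s) < ?f b" if "b \<noteq> (\<beta>0, \<beta>d, \<beta>s)" for b
  proof (rule ccontr)
    assume "\<not> ?f (\<beta>0, \<beta>d, \<beta>s) < ?f b"
    then have "is_arg_min ?f (\<lambda>_. True) b"
      using min unfolding is_arg_min_def by (meson linorder_not_le order.strict_trans1)
    then show False
      using min assms(4) that by blast
  qed
  note quad = wls_objective_quadratic[OF i, folded a_def m_def n_def]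

  \<comment> \<open>These are the expectations of the averaged direct and spillover effects weighted
    by \<open>A (j i)\<close>, that is, the numerators of the two conditional expectations.\<close>
  let ?Md = "(m 1 1 - m 0 1) * pJ 1 + (m 1 0 - m 0 0) * pJ 0"
  let ?Ms = "(m 1 1 - m 1 0) * pI 1 + (m 0 1 - m 0 0) * pI 0"
  have parabola_d: "0 < p * (1 - p) * (a * t\<^sup>2 - 2 * t * (?Md - a * \<beta>d))"
    if t: "t \<noteq> 0" for t
  proof -
    \<comment> \<open>The fitted value moves by t times the centred treatment
      \<open>D i - p\<close>. This has mean zero and is uncorrelated with \<open>D (j i)\<close>, so
      the terms in \<beta>0 and \<beta>s cancel and its variance \<open>p * (1 - p)\<close> factors
      out.\<close>
    have "?f (\<beta>0 - p * t, \<beta>d + t, \<beta>s) - ?f (\<beta>0, \<beta>d, \<beta>s)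
        = p * (1 - p) * (a * t\<^sup>2 - 2 * t * (?Md - a * \<beta>d))"
      unfolding quad by (simp add: p0 q0 p_def[symmetric] q_def[symmetric] power2_eq_square
          algebra_simps del: One_nat_def)
    then show ?thesis
      using strict[of "(\<beta>0 - p * t, \<beta>d + t, \<beta>s)"] t by simp
  qed
  \<comment> \<open>Besides the vertex equation this gives a conditioning event of positive
    probability, so \<open>cond_expect\<close> is not at its junk value.\<close>
  have a: "a \<noteq> 0" and d: "?Md - a * \<beta>d = 0"
    using strict_parabola_min_at_zero[of "p * (1 - p)" a "?Md - a * \<beta>d"] parabola_d by blast+
  have parabola_s: "0 < q * (1 - q) * (a * t\<^sup>2 - 2 * t * (?Ms - a * \<beta>s))"
    if t: "t \<noteq> 0" for t
  proof -
    \<comment> \<open>The same cancellation with the treatments exchanged: the fitted value moves by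
      t times \<open>D (j i) - q\<close>.\<close>
    have "?f (\<beta>0 - q * t, \<beta>d, \<beta>s + t) - ?f (\<beta>0, \<beta>d, \<beta>s)
        = q * (1 - q) * (a * t\<^sup>2 - 2 * t * (?Ms - a * \<beta>s))"
      unfolding quad by (simp add: p0 q0 p_def[symmetric] q_def[symmetric] power2_eq_square
          algebra_simps del: One_nat_def)
    then show ?thesis
      using strict[of "(\<beta>0 - q * t, \<beta>d, \<beta>s + t)"] t by simp
  qed
  have s: "?Ms - a * \<beta>s = 0"
    using strict_parabola_min_at_zero(2)[of "q * (1 - q)" a "?Ms - a * \<beta>s"] parabola_s by blast

  have [measurable]: "Y i (0, 0) \<in> borel_measurable M" "Y i (0, 1) \<in> borel_measurable M"
      "Y i (1, 0) \<in> borel_measurable M" "Y i (1, 1) \<in> borel_measurable M"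
    using outcome_rv[OF i] by auto
  have [simp]: "integrable M (\<lambda>\<omega>. real (A (j i) \<omega>) * Y i (0, 0) \<omega>)"
      "integrable M (\<lambda>\<omega>. real (A (j i) \<omega>) * Y i (0, 1) \<omega>)"
      "integrable M (\<lambda>\<omega>. real (A (j i) \<omega>) * Y i (1, 0) \<omega>)"
      "integrable M (\<lambda>\<omega>. real (A (j i) \<omega>) * Y i (1, 1) \<omega>)"
    using integrable_interaction_outcome[OF i] by auto
  have "expectation (\<lambda>\<omega>. real (A (j i) \<omega>) * avg_direct_effect pJ Y i \<omega>)
      = expectation (\<lambda>\<omega>.
          (real (A (j i) \<omega>) * Y i (1, 1) \<omega> - real (A (j i) \<omega>) * Y i (0, 1) \<omega>) * pJ 1
          + (real (A (j i) \<omega>) * Y i (1, 0) \<omega> - real (A (j i) \<omega>) * Y i (0, 0) \<omega>) * pJ 0)"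
    by (simp only: avg_direct_effect_def direct_effect_def algebra_simps)
  also have "\<dots> = ?Md"
    by (simp add: m_def del: One_nat_def)
  finally have "expectation (\<lambda>\<omega>. real (A (j i) \<omega>) * avg_direct_effect pJ Y i \<omega>) = a * \<beta>d"
    using d by simp
  moreover have "expectation (\<lambda>\<omega>. real (A (j i) \<omega>) * avg_spillover_effect pI Y i \<omega>)
      = expectation (\<lambda>\<omega>.
          (real (A (j i) \<omega>) * Y i (1, 1) \<omega> - real (A (j i) \<omega>) * Y i (1, 0) \<omega>) * pI 1
          + (real (A (j i) \<omega>) * Y i (0, 1) \<omega> - real (A (j i) \<omega>) * Y i (0, 0) \<omega>) * pI 0)"
    by (simp only: avg_spillover_effect_def spillover_effect_def algebra_simps)
  moreover have "\<dots> = ?Ms"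
    by (simp add: m_def del: One_nat_def)
  moreover have "avg_direct_effect pJ Y i \<in> borel_measurable M"
      "avg_spillover_effect pI Y i \<in> borel_measurable M"
    unfolding avg_direct_effect_def direct_effect_def avg_spillover_effect_def spillover_effect_def
    by measurable
  ultimately show ?thesis
    using a s cond_expect_interaction[OF i] unfolding a_def[symmetric] by simp
qed

end
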